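(* Consider $\mathbb{R}$ with density $f(x)=|x|$. Let $0<M_1\le M_2\le M_3\le M_4$. The solution of the isoperimetric problem for four regions of masses $M_1,M_2,M_3,M_4$ is the following condensed configuration, in which each region consists of a single interval and there are two intervals on each side of the origin: the intervals of mass $M_1$ and $M_2$ are adjacent to the origin (both have the origin as an endpoint, on opposite sides of it); the interval of mass $M_3$ is adjacent to the interval of mass $M_1$ (on the same side of the origin, farther out); and the interval of mass $M_4$ is adjacent to the interval of mass $M_2$ (on the same side of the origin, farther out). That is, this configuration is isoperimetric: it has the least total perimeter among all configurations of four regions with masses $M_1,M_2,M_3,M_4$.
   Context: A density on $\mathbb{R}$ is a nonnegative function $f$. The weighted mass of an interval $[a,b]$ is $\int_a^b f$. A region is a (finite or countably infinite) collection of pairwise disjoint intervals $[a_i,b_i]$; its mass is $\sum_i\int_{a_i}^{b_i} f$. A configuration of $n$ regions consists of $n$ regions on the same line such that any two intervals from different regions are either disjoint or meet at a single endpoint. The total (weighted) perimeter of a configuration is the sum of $f(x)$ over all interval endpoints $x$ of all its regions, where an endpoint shared by two intervals is counted only once. A configuration of $n$ regions with masses $M_1,\dots,M_n$ is isoperimetric (an $n$-bubble) if it has the least total perimeter among all configurations of $n$ regions with these same masses. A condensed configuration of $n$ regions is one consisting of at most $2n$ adjacent intervals (consecutive intervals share an endpoint, so there are no gaps), with at most two intervals per region, and with the origin contained either in the interior of an interval or at an endpoint of at least one interval. *)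

theory Defs
  imports "HOL-Analysis.Analysis"
begin

text \<open>
  The nondegenerate compact interval from a to b is represented by the pair of its endpoints.
  Masses and perimeters take values in the extended nonnegative reals, because a region may have
  infinitely many intervals, so that the sums involved may diverge.
\<close>

type_synonym intvl = "real \<times> real"

definition pts :: "intvl \<Rightarrow> real set" where
  "pts I = {fst I..snd I}"

definition endpoints :: "intvl \<Rightarrow> real set" where
  "endpoints I = {fst I, snd I}"

definition interval_mass :: "(real \<Rightarrow> real) \<Rightarrow> intvl \<Rightarrow> ennreal" where
  "interval_mass f I = (\<integral>\<^sup>+x\<in>pts I. ennreal (f x) \<partial>lborel)"

definition region :: "intvl set \<Rightarrow> bool" where
  "region R \<longleftrightarrow> countable R \<and> (\<forall>I\<in>R. fst I < snd I) \<and>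
     (\<forall>I\<in>R. \<forall>J\<in>R. I \<noteq> J \<longrightarrow> pts I \<inter> pts J = {})"

definition region_mass :: "(real \<Rightarrow> real) \<Rightarrow> intvl set \<Rightarrow> ennreal" where
  "region_mass f R = (\<Sum>\<^sub>\<infinity>I\<in>R. interval_mass f I)"

text \<open>
  A configuration of n regions is a family indexed by the numbers from 1 to n; the values of the
  function at other indices are irrelevant.
\<close>

definition configuration :: "nat \<Rightarrow> (nat \<Rightarrow> intvl set) \<Rightarrow> bool" where
  "configuration n C \<longleftrightarrow> (\<forall>i\<in>{1..n}. region (C i)) \<and>
     (\<forall>i\<in>{1..n}. \<forall>j\<in>{1..n}. i \<noteq> j \<longrightarrow> (\<forall>I\<in>C i. \<forall>J\<in>C j.
        pts I \<inter> pts J = {} \<or> (\<exists>x\<in>endpoints I \<inter> endpoints J. pts I \<inter> pts J = {x})))"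

definition all_intervals :: "nat \<Rightarrow> (nat \<Rightarrow> intvl set) \<Rightarrow> intvl set" where
  "all_intervals n C = (\<Union>i\<in>{1..n}. C i)"

text \<open>The sum runs over a set of points, so a shared endpoint is counted only once.\<close>

definition perimeter :: "(real \<Rightarrow> real) \<Rightarrow> nat \<Rightarrow> (nat \<Rightarrow> intvl set) \<Rightarrow> ennreal" where
  "perimeter f n C = (\<Sum>\<^sub>\<infinity>x\<in>(\<Union>I\<in>all_intervals n C. endpoints I). ennreal (f x))"

definition has_masses :: "(real \<Rightarrow> real) \<Rightarrow> nat \<Rightarrow> (nat \<Rightarrow> real) \<Rightarrow> (nat \<Rightarrow> intvl set) \<Rightarrow> bool" where
  "has_masses f n M C \<longleftrightarrow> (\<forall>i\<in>{1..n}. region_mass f (C i) = ennreal (M i))"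

definition isoperimetric :: "(real \<Rightarrow> real) \<Rightarrow> nat \<Rightarrow> (nat \<Rightarrow> real) \<Rightarrow> (nat \<Rightarrow> intvl set) \<Rightarrow> bool" where
  "isoperimetric f n M C \<longleftrightarrow> configuration n C \<and> has_masses f n M C \<and>
     (\<forall>C'. configuration n C' \<and> has_masses f n M C' \<longrightarrow> perimeter f n C \<le> perimeter f n C')"

text \<open>The list enumerates the intervals from left to right, without gaps.\<close>

definition condensed :: "nat \<Rightarrow> (nat \<Rightarrow> intvl set) \<Rightarrow> bool" where
  "condensed n C \<longleftrightarrow> configuration n C \<and>
     (\<exists>Is. set Is = all_intervals n C \<and> length Is \<le> 2 * n \<and>
           successively (\<lambda>I J. snd I = fst J) Is) \<and>
     (\<forall>i\<in>{1..n}. finite (C i) \<and> card (C i) \<le> 2) \<and>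
     (\<exists>I\<in>all_intervals n C. 0 \<in> interior (pts I) \<or> 0 \<in> endpoints I)"

text \<open>
  Regions 1 and 3 may lie on either side of the origin; the two disjuncts are mirror images.
\<close>

definition four_bubble_layout :: "(nat \<Rightarrow> intvl set) \<Rightarrow> bool" where
  "four_bubble_layout C \<longleftrightarrow>
     (\<exists>a b c d. a < b \<and> b < 0 \<and> 0 < c \<and> c < d \<and>
        (C 3 = {(a, b)} \<and> C 1 = {(b, 0)} \<and> C 2 = {(0, c)} \<and> C 4 = {(c, d)} \<or>
         C 4 = {(a, b)} \<and> C 2 = {(b, 0)} \<and> C 1 = {(0, c)} \<and> C 3 = {(c, d)}))"

end

theory Submission imports Defs begin

text \<open>
  The interval from the origin to \<open>x\<close> has mass \<open>x\<^sup>2 / 2\<close>, so an endpoint that has mass \<open>m\<close> between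
  itself and the origin costs \<open>sqrt (2 * m)\<close>, a concave function of \<open>m\<close>, and the origin itself costs
  nothing. Hence a configuration may be cut at the origin for free, and the two half-lines can be
  treated separately.

  Consider a configuration of finite perimeter, and let \<open>r i\<close> be the mass of region \<open>i\<close> on the right
  half-line. The outermost endpoints of the regions on this half-line are different points. The one
  in position \<open>j\<close> has \<open>j\<close> regions between itself and the origin, so its distance from the origin is
  at least \<open>sqrt (2 * s)\<close>, where \<open>s\<close> is the sum of the \<open>j\<close> smallest of the \<open>r i\<close>. The sum of these
  bounds is \<open>side_cost r\<close>. The left half-line, with the remaining masses \<open>M i - r i\<close>, is treated
  alike (lemma \<open>perimeter_ge_side_costs\<close>).

  Each sum of the \<open>j\<close> smallest entries is a minimum of linear functions, so \<open>side_cost\<close> is concave,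
  and so is the sum of the costs of the two sides as a function of \<open>r\<close> on the box of all \<open>r\<close> with
  \<open>0 \<le> r i \<le> M i\<close>. A concave function on a box is bounded below by its value at some vertex, that
  is, by the cost when every region lies entirely on one side (lemma \<open>perimeter_ge_vertex\<close>). For
  four regions there are sixteen vertices, eight up to reflection, and concavity of the square root
  shows that none is cheaper than regions 1 and 3 on one side and 2 and 4 on the other (lemma
  \<open>four_bubble_cost_le_vertex\<close>). The layout of the theorem attains exactly this value (lemma
  \<open>four_bubble_perimeter\<close>).
\<close>

section \<open>The cost of one half-line\<close>

definition least_sum :: "'a set \<Rightarrow> ('a \<Rightarrow> real) \<Rightarrow> nat \<Rightarrow> real" where
  "least_sum K r j = Min (sum r ` {A. A \<subseteq> K \<and> card A = j})"

text \<open>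
  On a half-line starting at the origin, single intervals of masses \<open>r k\<close> that are lined up in
  increasing order of mass end at distances \<open>sqrt (2 * s)\<close> from the origin, where \<open>s\<close> runs through
  the sums of the smallest masses. The sum of these distances is expressed through minima over
  subsets, and not through a sorted enumeration, because minima of linear functions are visibly
  concave in \<open>r\<close>.
\<close>

definition side_cost :: "'a set \<Rightarrow> ('a \<Rightarrow> real) \<Rightarrow> real" where
  "side_cost K r = (\<Sum>j=1..card K. sqrt (2 * least_sum K r j))"

lemma finite_card_subsets: "finite K \<Longrightarrow> finite {A. A \<subseteq> K \<and> card A = j}"
  by (rule finite_subset[of _ "Pow K"]) auto

lemma least_sum_le:
  assumes "finite K" "A \<subseteq> K"
  shows "least_sum K r (card A) \<le> sum r A"
  unfolding least_sum_def using assms finite_card_subsets[of K "card A"] by (intro Min_le) auto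

lemma least_sum_attained:
  assumes "finite K" "j \<le> card K"
  obtains A where "A \<subseteq> K" "card A = j" "least_sum K r j = sum r A"
proof -
  obtain B where "B \<subseteq> K" "card B = j"
    using obtain_subset_with_card_n[OF assms(2)] by metis
  hence "least_sum K r j \<in> sum r ` {A. A \<subseteq> K \<and> card A = j}"
    unfolding least_sum_def using assms finite_card_subsets[of K j] by (intro Min_in) auto
  thus ?thesis using that by auto
qed

lemma least_sum_nonneg:
  assumes "finite K" "j \<le> card K" "\<And>k. k \<in> K \<Longrightarrow> 0 \<le> r k"
  shows "0 \<le> least_sum K r j"
proof -
  obtain A where "A \<subseteq> K" "least_sum K r j = sum r A"
    using least_sum_attained[OF assms(1,2)] by metis
  thus ?thesis using assms(3) by (metis subsetD sum_nonneg)
qed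

lemma least_sum_full: "finite K \<Longrightarrow> least_sum K r (card K) = sum r K"
  by (rule least_sum_attained[of K "card K" r]) (use card_subset_eq in blast)+

lemma least_sum_antimono:
  assumes "finite L" "K \<subseteq> L" "j \<le> card K"
  shows "least_sum L r j \<le> least_sum K r j"
proof -
  have "finite K" using assms finite_subset by blast
  then obtain A where "A \<subseteq> K" "card A = j" "least_sum K r j = sum r A"
    using least_sum_attained assms(3) by metis
  thus ?thesis using least_sum_le[of L A r] assms by auto
qed

lemma side_cost_insert_le:
  assumes "finite K" "m \<notin> K"
  shows "side_cost (insert m K) r \<le> side_cost K r + sqrt (2 * sum r (insert m K))"
proof -
  have "(\<Sum>j=1..card K. sqrt (2 * least_sum (insert m K) r j))
      \<le> (\<Sum>j=1..card K. sqrt (2 * least_sum K r j))"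
    using assms least_sum_antimono[of "insert m K" K] by (intro sum_mono) auto
  moreover have "least_sum (insert m K) r (Suc (card K)) = sum r (insert m K)"
    using least_sum_full[of "insert m K" r] assms by simp
  ultimately show ?thesis using assms by (simp add: side_cost_def)
qed

text \<open>
  A cheapest subset that contains the largest entry \<open>m\<close>, but not all of \<open>K\<close>, stays cheapest when \<open>m\<close> is
  exchanged for a missing element of \<open>K\<close>. Adding the entries in increasing order therefore
  evaluates the cost, as \<open>side_cost_four\<close> does for four entries.
\<close>

lemma side_cost_insert_largest:
  assumes "finite K" "m \<notin> K" "\<And>k. k \<in> K \<Longrightarrow> r k \<le> r m"
  shows "side_cost (insert m K) r = side_cost K r + sqrt (2 * sum r (insert m K))"
proof -
  have "least_sum (insert m K) r j = least_sum K r j" if j: "j \<le> card K" for j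
  proof (rule antisym)
    show "least_sum (insert m K) r j \<le> least_sum K r j"
      using assms j by (intro least_sum_antimono) auto
    obtain A where A: "A \<subseteq> insert m K" "card A = j" "least_sum (insert m K) r j = sum r A"
      using least_sum_attained[of "insert m K" j r] j assms by auto
    have finA: "finite A" using A(1) assms(1) finite_subset by blast
    show "least_sum K r j \<le> least_sum (insert m K) r j"
    proof (cases "m \<in> A")
      case False
      thus ?thesis using A least_sum_le[of K A r] assms by auto
    next
      case True
      have "\<not> K \<subseteq> A - {m}"
      proof
        assume "K \<subseteq> A - {m}"
        hence "card K \<le> card (A - {m})" using finA by (intro card_mono) auto
        thus False using A j True finA by (metis card_Diff1_less leD le_trans)
      qed
      then obtain k where k: "k \<in> K" "k \<notin> A" using assms(2) by auto
      define B where "B = insert k (A - {m})"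
      have "card B = j" "B \<subseteq> K" using A True k finA card_Suc_Diff1[of A m]
        by (auto simp: B_def)
      moreover have "sum r B \<le> sum r A"
        using assms(3)[OF k(1)] k(2) finA True sum.remove[of A m r] by (simp add: B_def)
      ultimately show ?thesis using A(3) least_sum_le[of K B r] assms(1) by auto
    qed
  qed
  moreover have "least_sum (insert m K) r (Suc (card K)) = sum r (insert m K)"
    using least_sum_full[of "insert m K" r] assms by simp
  ultimately show ?thesis using assms by (simp add: side_cost_def)
qed

lemma side_cost_cong:
  assumes "\<And>k. k \<in> K \<Longrightarrow> r k = s k"
  shows "side_cost K r = side_cost K s"
proof -
  have "sum r ` {A. A \<subseteq> K \<and> card A = j} = sum s ` {A. A \<subseteq> K \<and> card A = j}" for j
    using assms by (intro image_cong refl sum.cong) auto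
  thus ?thesis by (simp add: side_cost_def least_sum_def)
qed

lemma side_cost_empty [simp]: "side_cost {} r = 0"
  by (simp add: side_cost_def)

lemma side_cost_four:
  assumes "distinct [a, b, c, d]" "r a \<le> r b" "r b \<le> r c" "r c \<le> r d"
  shows "side_cost {a, b, c, d} r = sqrt (2 * r a) + sqrt (2 * (r a + r b))
    + sqrt (2 * (r a + r b + r c)) + sqrt (2 * (r a + r b + r c + r d))"
proof -
  have "side_cost {a} r = sqrt (2 * r a)"
    using side_cost_insert_largest[of "{}" a r] by simp
  moreover have "side_cost {b, a} r = side_cost {a} r + sqrt (2 * sum r {b, a})"
    using assms by (intro side_cost_insert_largest) auto
  moreover have "side_cost {c, b, a} r = side_cost {b, a} r + sqrt (2 * sum r {c, b, a})"
    using assms by (intro side_cost_insert_largest) auto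
  moreover have "side_cost {d, c, b, a} r = side_cost {c, b, a} r + sqrt (2 * sum r {d, c, b, a})"
    using assms by (intro side_cost_insert_largest) auto
  moreover have "sum r {b, a} = r a + r b" "sum r {c, b, a} = r a + r b + r c"
    "sum r {d, c, b, a} = r a + r b + r c + r d" using assms(1) by auto
  moreover have "{a, b, c, d} = {d, c, b, a}" by auto
  ultimately show ?thesis by simp
qed

text \<open>
  Here \<open>p i\<close> stands for the outermost endpoint of region \<open>i\<close> on the half-line. The hypothesis says
  that regions that end before \<open>b\<close> fit into \<open>[0, b]\<close>, whose mass is \<open>b\<^sup>2 / 2\<close>. If \<open>m\<close> is the region
  that ends last, then the masses of all regions fit into \<open>[0, p m]\<close>, which pays for the last summand
  of the cost; the others are paid for by induction.
\<close>

lemma side_cost_le_sum: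
  assumes "finite K"
    and "\<And>A b. A \<subseteq> K \<Longrightarrow> 0 \<le> b \<Longrightarrow> (\<And>i. i \<in> A \<Longrightarrow> p i \<le> b) \<Longrightarrow> 2 * sum r A \<le> b\<^sup>2"
    and "\<And>i. i \<in> K \<Longrightarrow> 0 \<le> p i"
  shows "side_cost K r \<le> sum p K"
  using assms
proof (induction K rule: finite_ranking_induct[where f = p])
  case empty
  thus ?case by simp
next
  case (insert m K)
  show ?case
  proof (cases "m \<in> K")
    case True
    thus ?thesis using insert by (simp add: insert_absorb)
  next
    case False
    have "2 * sum r (insert m K) \<le> (p m)\<^sup>2"
      using insert.hyps insert.prems(2) by (intro insert.prems(1)) auto
    hence "sqrt (2 * sum r (insert m K)) \<le> p m"
      using insert.prems(2)[of m] by (simp add: real_le_lsqrt)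
    moreover have "side_cost K r \<le> sum p K"
      using insert.prems by (intro insert.IH) auto
    ultimately show ?thesis
      using side_cost_insert_le[OF insert.hyps(1) False, of r] insert.hyps(1) False by simp
  qed
qed

section \<open>Concavity and reduction to vertices\<close>

lemma sqrt_concave:
  assumes "0 \<le> u" "u \<le> 1" "0 \<le> x" "0 \<le> y"
  shows "(1 - u) * sqrt x + u * sqrt y \<le> sqrt ((1 - u) * x + u * y)"
proof (rule real_le_rsqrt)
  have "((1 - u) * x + u * y) - ((1 - u) * sqrt x + u * sqrt y)\<^sup>2
      = u * (1 - u) * (sqrt x - sqrt y)\<^sup>2"
    using assms(3,4) by (simp add: power2_eq_square algebra_simps)
  moreover have "0 \<le> \<dots>" using assms by simp
  ultimately show "((1 - u) * sqrt x + u * sqrt y)\<^sup>2 \<le> (1 - u) * x + u * y"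
    by linarith
qed

text \<open>
  A subset that attains the minimum for the mixture is a candidate for both ends of the segment, so
  each minimum is concave; the square root is concave and increasing and preserves this.
\<close>

lemma side_cost_concave:
  fixes r s :: "'a \<Rightarrow> real"
  assumes "finite K" "0 \<le> u" "u \<le> 1"
    and "\<And>k. k \<in> K \<Longrightarrow> 0 \<le> r k" "\<And>k. k \<in> K \<Longrightarrow> 0 \<le> s k"
  shows "(1 - u) * side_cost K r + u * side_cost K s
    \<le> side_cost K (\<lambda>k. (1 - u) * r k + u * s k)"
proof -
  let ?t = "\<lambda>k. (1 - u) * r k + u * s k"
  have "(1 - u) * sqrt (2 * least_sum K r j) + u * sqrt (2 * least_sum K s j)
      \<le> sqrt (2 * least_sum K ?t j)" if j: "j \<le> card K" for j
  proof -
    obtain A where A: "A \<subseteq> K" "card A = j" "least_sum K ?t j = sum ?t A"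
      using least_sum_attained[OF assms(1) j] by metis
    have "least_sum K ?t j = (1 - u) * sum r A + u * sum s A"
      using A(3) by (simp add: sum.distrib sum_distrib_left)
    moreover have "(1 - u) * least_sum K r j \<le> (1 - u) * sum r A"
      "u * least_sum K s j \<le> u * sum s A"
      using least_sum_le[OF assms(1) A(1)] A(2) assms(2,3) by (auto intro!: mult_left_mono)
    ultimately have "(1 - u) * (2 * least_sum K r j) + u * (2 * least_sum K s j)
        \<le> 2 * least_sum K ?t j"
      by (simp add: algebra_simps)
    moreover have "(1 - u) * sqrt (2 * least_sum K r j) + u * sqrt (2 * least_sum K s j)
        \<le> sqrt ((1 - u) * (2 * least_sum K r j) + u * (2 * least_sum K s j))"
      using assms j by (intro sqrt_concave) (auto intro: least_sum_nonneg)
    ultimately show ?thesis by (meson order_trans real_sqrt_le_iff)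
  qed
  hence "(\<Sum>j=1..card K. (1 - u) * sqrt (2 * least_sum K r j) + u * sqrt (2 * least_sum K s j))
      \<le> side_cost K ?t"
    unfolding side_cost_def by (intro sum_mono) auto
  thus ?thesis by (simp add: side_cost_def sum.distrib sum_distrib_left)
qed

text \<open>
  One coordinate is pushed to an end of its range at a time: along the segment in direction \<open>b\<close> the
  concave function is at least a weighted mean of its values at the two ends, so one of the ends is
  no worse.
\<close>

lemma concave_box_vertex:
  fixes \<phi> :: "('a \<Rightarrow> real) \<Rightarrow> real"
  assumes "finite B"
    and concave: "\<And>u x y. \<lbrakk>0 \<le> u; u \<le> 1; \<And>k. k \<in> K \<Longrightarrow> 0 \<le> x k \<and> x k \<le> M k;
        \<And>k. k \<in> K \<Longrightarrow> 0 \<le> y k \<and> y k \<le> M k\<rbrakk>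
      \<Longrightarrow> (1 - u) * \<phi> x + u * \<phi> y \<le> \<phi> (\<lambda>k. (1 - u) * x k + u * y k)"
    and r: "\<And>k. k \<in> K \<Longrightarrow> 0 \<le> r k \<and> r k \<le> M k"
    and "B \<subseteq> K"
  shows "\<exists>v. (\<forall>k\<in>K. 0 \<le> v k \<and> v k \<le> M k) \<and> (\<forall>k\<in>B. v k = 0 \<or> v k = M k) \<and> \<phi> v \<le> \<phi> r"
  using \<open>finite B\<close> \<open>B \<subseteq> K\<close>
proof (induction B)
  case empty
  thus ?case using r by auto
next
  case (insert b B)
  then obtain v where v: "\<forall>k\<in>K. 0 \<le> v k \<and> v k \<le> M k" "\<forall>k\<in>B. v k = 0 \<or> v k = M k"
    "\<phi> v \<le> \<phi> r" by auto
  define u where "u = v b / M b"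
  have b: "0 \<le> v b" "v b \<le> M b" using v insert.prems by auto
  have u: "0 \<le> u" "u \<le> 1" using b by (auto simp: u_def divide_le_eq_1)
  have "v b = u * M b" using b by (auto simp: u_def)
  hence "v = (\<lambda>k. (1 - u) * (v(b := 0)) k + u * (v(b := M b)) k)"
    by (auto simp: algebra_simps)
  moreover have "(1 - u) * \<phi> (v(b := 0)) + u * \<phi> (v(b := M b))
      \<le> \<phi> (\<lambda>k. (1 - u) * (v(b := 0)) k + u * (v(b := M b)) k)"
    using u v b by (intro concave) auto
  ultimately have le: "(1 - u) * \<phi> (v(b := 0)) + u * \<phi> (v(b := M b)) \<le> \<phi> v"
    by simp
  have "\<phi> (v(b := 0)) \<le> \<phi> v \<or> \<phi> (v(b := M b)) \<le> \<phi> v"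
  proof (rule ccontr)
    assume "\<not> ?thesis"
    hence *: "\<phi> v < \<phi> (v(b := 0))" "\<phi> v < \<phi> (v(b := M b))" by auto
    have "\<phi> v = (1 - u) * \<phi> v + u * \<phi> v" by (simp add: algebra_simps)
    also have "\<dots> < (1 - u) * \<phi> (v(b := 0)) + u * \<phi> (v(b := M b))"
    proof (cases "u = 0")
      case False
      thus ?thesis using * u
        by (intro add_le_less_mono mult_left_mono mult_strict_left_mono) auto
    qed (use * in auto)
    finally show False using le by simp
  qed
  then obtain c where "c = 0 \<or> c = M b" "\<phi> (v(b := c)) \<le> \<phi> v" by auto
  hence "\<phi> (v(b := c)) \<le> \<phi> r" "\<forall>k\<in>K. 0 \<le> (v(b := c)) k \<and> (v(b := c)) k \<le> M k"
    "\<forall>k\<in>insert b B. (v(b := c)) k = 0 \<or> (v(b := c)) k = M k"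
    using v b by (auto split: if_splits)
  thus ?case by blast
qed

section \<open>Comparing the ways to distribute four regions\<close>

text \<open>
  By concavity, moving two numbers apart with fixed sum decreases the sum of their square roots, and
  so does making one of them smaller. After squaring, it remains to see that \<open>a * d \<le> b * c\<close>, which
  for the largest possible \<open>d\<close> means \<open>(b - a) * (c - a) \<ge> 0\<close>.
\<close>

lemma sqrt_spread:
  assumes "0 \<le> a" "a \<le> b" "a \<le> c" "0 \<le> d" "a + d \<le> b + c"
  shows "sqrt a + sqrt d \<le> sqrt b + sqrt c"
proof -
  have "0 \<le> (b - a) * (c - a)" using assms by simp
  hence "a * (b + c - a) \<le> b * c" by (simp add: algebra_simps)
  moreover have "a * d \<le> a * (b + c - a)" using assms by (intro mult_left_mono) auto
  ultimately have "sqrt a * sqrt d \<le> sqrt b * sqrt c"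
    by (simp flip: real_sqrt_mult)
  hence "(sqrt a + sqrt d)\<^sup>2 \<le> (sqrt b + sqrt c)\<^sup>2"
    using assms by (simp add: power2_sum)
  thus ?thesis by (rule power2_le_imp_le) (use assms in auto)
qed

text \<open>
  This is the perimeter of the layout in the theorem, for either mirror image.
\<close>

definition four_bubble_cost :: "(nat \<Rightarrow> real) \<Rightarrow> real" where
  "four_bubble_cost M = sqrt (2 * M 1) + sqrt (2 * M 2)
     + sqrt (2 * (M 1 + M 3)) + sqrt (2 * (M 2 + M 4))"

text \<open>
  At a vertex each region lies entirely on one side, with masses \<open>v\<close> on the right and \<open>w\<close> on the left.
  After swapping the sides if necessary, region 4 is on the left; this leaves eight distributions. In each
  one, the terms that differ from the claimed minimum are compared one by one, or in pairs by
  \<open>sqrt_spread\<close>. The distribution of regions 1, 2, 3 against region 4 needs two such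
  exchanges, through the intermediate term \<open>sqrt (2 * (M 1 + M 4))\<close>.
\<close>

lemma four_bubble_cost_le_vertex_left:
  fixes M v w :: "nat \<Rightarrow> real"
  assumes M: "0 < M 1" "M 1 \<le> M 2" "M 2 \<le> M 3" "M 3 \<le> M 4"
    and v: "\<forall>k\<in>{1..4}. v k = 0 \<or> v k = M k"
    and w: "\<forall>k\<in>{1..4}. v k + w k = M k"
    and v4: "v 4 = 0"
  shows "four_bubble_cost M \<le> side_cost {1..4} v + side_cost {1..4} w"
proof -
  have cost: "side_cost {1..4} r = sqrt (2 * r a) + sqrt (2 * (r a + r b))
    + sqrt (2 * (r a + r b + r c)) + sqrt (2 * (r a + r b + r c + r d))"
    if "r a \<le> r b" "r b \<le> r c" "r c \<le> r d"
      and idx: "distinct [a, b, c, d]" "{a, b, c, d} \<subseteq> {1..4}"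
    for a b c d :: nat and r
  proof -
    have "{a, b, c, d} = {1..4}"
      using idx by (intro card_subset_eq) auto
    thus ?thesis using side_cost_four[of a b c d r] that by simp
  qed
  have w4: "w 4 = M 4" using bspec[OF w, of 4] v4 by simp
  have "v 1 = 0 \<and> w 1 = M 1 \<or> v 1 = M 1 \<and> w 1 = 0" "v 2 = 0 \<and> w 2 = M 2 \<or> v 2 = M 2 \<and> w 2 = 0"
    "v 3 = 0 \<and> w 3 = M 3 \<or> v 3 = M 3 \<and> w 3 = 0"
    using bspec[OF v, of 1] bspec[OF w, of 1] bspec[OF v, of 2] bspec[OF w, of 2]
      bspec[OF v, of 3] bspec[OF w, of 3] by auto
  thus ?thesis
    \<comment> \<open>A region that is absent from a side enters its cost with mass 0 and is listed first in the
      increasing enumerations passed to \<open>cost\<close> below.\<close>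
  proof (elim disjE conjE, goal_cases)
    case 1
    have "sqrt (2 * M 2) \<le> sqrt (2 * (M 1 + M 2))"
      "sqrt (2 * (M 1 + M 3)) \<le> sqrt (2 * (M 1 + M 2 + M 3))"
      "sqrt (2 * (M 2 + M 4)) \<le> sqrt (2 * (M 1 + M 2 + M 3 + M 4))"
      using M by auto
    hence "sqrt (2 * M 2) + (sqrt (2 * (M 1 + M 3)) + sqrt (2 * (M 2 + M 4)))
        \<le> sqrt (2 * (M 1 + M 2)) + (sqrt (2 * (M 1 + M 2 + M 3))
          + sqrt (2 * (M 1 + M 2 + M 3 + M 4)))"
      by (intro add_mono)
    thus ?thesis using 1 v4 w4 M cost[of v 1 2 3 4] cost[of w 1 2 3 4]
      by (auto simp add: four_bubble_cost_def)
  next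
    case 2
    have "sqrt (2 * M 2) + sqrt (2 * (M 1 + M 3)) \<le> sqrt (2 * (M 1 + M 2)) + sqrt (2 * M 3)"
      using M by (intro sqrt_spread) auto
    moreover have "sqrt (2 * (M 2 + M 4)) \<le> sqrt (2 * (M 1 + M 2 + M 4))" using M by auto
    ultimately have "sqrt (2 * M 2) + sqrt (2 * (M 1 + M 3)) + sqrt (2 * (M 2 + M 4))
        \<le> sqrt (2 * (M 1 + M 2)) + sqrt (2 * M 3) + sqrt (2 * (M 1 + M 2 + M 4))"
      by (rule add_mono)
    thus ?thesis using 2 v4 w4 M cost[of v 1 2 4 3] cost[of w 3 1 2 4]
      by (auto simp add: four_bubble_cost_def)
  next
    case 3
    have "sqrt (2 * (M 2 + M 4)) \<le> sqrt (2 * (M 1 + M 3 + M 4))" using M by auto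
    thus ?thesis using 3 v4 w4 M cost[of v 1 3 4 2] cost[of w 2 1 3 4]
      by (auto simp add: four_bubble_cost_def)
  next
    case 4
    have "sqrt (2 * (M 1 + M 3)) + sqrt (2 * (M 2 + M 4))
        \<le> sqrt (2 * (M 2 + M 3)) + sqrt (2 * (M 1 + M 4))"
      using M by (intro sqrt_spread) auto
    thus ?thesis using 4 v4 w4 M cost[of v 1 4 2 3] cost[of w 2 3 1 4]
      by (auto simp add: four_bubble_cost_def)
  next
    case 5
    have "sqrt (2 * (M 1 + M 3)) \<le> sqrt (2 * (M 2 + M 3))"
      "sqrt (2 * (M 2 + M 4)) \<le> sqrt (2 * (M 2 + M 3 + M 4))" using M by auto
    hence "sqrt (2 * (M 1 + M 3)) + sqrt (2 * (M 2 + M 4))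
        \<le> sqrt (2 * (M 2 + M 3)) + sqrt (2 * (M 2 + M 3 + M 4))"
      by (rule add_mono)
    thus ?thesis using 5 v4 w4 M cost[of v 2 3 4 1] cost[of w 1 2 3 4]
      by (auto simp add: four_bubble_cost_def)
  next
    case 6
    thus ?thesis using v4 w4 M cost[of v 2 4 1 3] cost[of w 1 3 2 4]
      by (auto simp add: four_bubble_cost_def)
  next
    case 7
    have "sqrt (2 * M 2) + sqrt (2 * (M 1 + M 3)) \<le> sqrt (2 * (M 1 + M 2)) + sqrt (2 * M 3)"
      using M by (intro sqrt_spread) auto
    moreover have "sqrt (2 * (M 2 + M 4)) \<le> sqrt (2 * (M 3 + M 4))" using M by auto
    ultimately have "sqrt (2 * M 2) + sqrt (2 * (M 1 + M 3)) + sqrt (2 * (M 2 + M 4))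
        \<le> sqrt (2 * (M 1 + M 2)) + sqrt (2 * M 3) + sqrt (2 * (M 3 + M 4))"
      by (rule add_mono)
    thus ?thesis using 7 v4 w4 M cost[of v 3 4 1 2] cost[of w 1 2 3 4]
      by (auto simp add: four_bubble_cost_def)
  next
    case 8
    have "sqrt (2 * M 2) + sqrt (2 * (M 1 + M 4)) \<le> sqrt (2 * (M 1 + M 2)) + sqrt (2 * M 4)"
      using M by (intro sqrt_spread) auto
    moreover have "sqrt (2 * (M 1 + M 3)) + sqrt (2 * (M 2 + M 4))
        \<le> sqrt (2 * (M 1 + M 4)) + sqrt (2 * (M 1 + M 2 + M 3))"
      using M by (intro sqrt_spread) auto
    ultimately show ?thesis using 8 v4 w4 M cost[of v 4 1 2 3] cost[of w 1 2 3 4]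
      by (auto simp add: four_bubble_cost_def)
  qed
qed

lemma four_bubble_cost_le_vertex:
  fixes M v w :: "nat \<Rightarrow> real"
  assumes M: "0 < M 1" "M 1 \<le> M 2" "M 2 \<le> M 3" "M 3 \<le> M 4"
    and v: "\<forall>k\<in>{1..4}. v k = 0 \<or> v k = M k"
    and w: "\<forall>k\<in>{1..4}. v k + w k = M k"
  shows "four_bubble_cost M \<le> side_cost {1..4} v + side_cost {1..4} w"
proof (cases "v 4 = 0")
  case True
  show ?thesis by (rule four_bubble_cost_le_vertex_left[OF M v w True])
next
  case False
  have "w 4 = 0" using False bspec[OF v, of 4] bspec[OF w, of 4] by simp
  moreover have "\<forall>k\<in>{1..4}. w k = 0 \<or> w k = M k" using v w by fastforce
  ultimately show ?thesis using four_bubble_cost_le_vertex_left[OF M, of w v] w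
    by (simp add: add.commute)
qed

section \<open>Mass as a measure\<close>

definition weight :: "real measure" where
  "weight = density lborel (\<lambda>x. ennreal \<bar>x\<bar>)"

text \<open>
  Open intervals make the bodies of different regions disjoint, although their closed intervals may
  share endpoints; the endpoints carry no mass.
\<close>

definition body :: "intvl set \<Rightarrow> real set" where
  "body R = (\<Union>I\<in>R. {fst I<..<snd I})"

lemma sets_weight [simp, measurable_cong]: "sets weight = sets borel"
  by (simp add: weight_def)

lemma abs_antiderivative: "((\<lambda>x::real. x * \<bar>x\<bar> / 2) has_real_derivative \<bar>x\<bar>) (at x)"
proof (cases "x = 0")
  case True
  have "((\<lambda>h::real. \<bar>h\<bar> / 2) \<longlongrightarrow> 0) (at 0)"
    by (auto intro!: tendsto_eq_intros)
  moreover have "\<forall>\<^sub>F h::real in at 0. \<bar>h\<bar> / 2 = (h * \<bar>h\<bar> / 2) / h"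
    by (auto simp: eventually_at_filter)
  ultimately have "((\<lambda>h::real. (h * \<bar>h\<bar> / 2) / h) \<longlongrightarrow> 0) (at 0)"
    using tendsto_cong by fast
  thus ?thesis using True by (simp add: DERIV_def)
next
  case False
  then consider "0 < x" | "x < 0" by linarith
  thus ?thesis
  proof cases
    case 1
    have "((\<lambda>x::real. x\<^sup>2 / 2) has_real_derivative \<bar>x\<bar>) (at x)"
      using 1 by (auto intro!: derivative_eq_intros)
    thus ?thesis
      by (rule has_field_derivative_transform_within_open[where S = "{0<..}"])
         (use 1 in \<open>auto simp: power2_eq_square\<close>)
  next
    case 2
    have "((\<lambda>x::real. - x\<^sup>2 / 2) has_real_derivative \<bar>x\<bar>) (at x)"
      using 2 by (auto intro!: derivative_eq_intros)
    thus ?thesis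
      by (rule has_field_derivative_transform_within_open[where S = "{..<0}"])
         (use 2 in \<open>auto simp: power2_eq_square\<close>)
  qed
qed

lemma emeasure_weight_Icc:
  assumes "a \<le> b"
  shows "emeasure weight {a..b} = ennreal (b * \<bar>b\<bar> / 2 - a * \<bar>a\<bar> / 2)"
proof -
  have "emeasure weight {a..b} = (\<integral>\<^sup>+x. ennreal \<bar>x\<bar> * indicator {a..b} x \<partial>lborel)"
    unfolding weight_def by (rule emeasure_density) auto
  also have "\<dots> = ennreal (b * \<bar>b\<bar> / 2 - a * \<bar>a\<bar> / 2)"
    using assms abs_antiderivative by (intro nn_integral_FTC_Icc[where F = "\<lambda>x. x * \<bar>x\<bar> / 2"])
      (auto intro: DERIV_subset has_field_derivative_at_within)
  finally show ?thesis .
qed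

lemma emeasure_weight_singleton [simp]: "emeasure weight {x} = 0"
  using emeasure_weight_Icc[of x x] by simp

lemma interval_mass_eq_weight_Icc: "interval_mass (\<lambda>x. \<bar>x\<bar>) I = emeasure weight {fst I..snd I}"
  unfolding interval_mass_def pts_def weight_def by (subst emeasure_density) auto

lemma interval_mass_eq:
  "a \<le> b \<Longrightarrow> interval_mass (\<lambda>x. \<bar>x\<bar>) (a, b) = ennreal (b * \<bar>b\<bar> / 2 - a * \<bar>a\<bar> / 2)"
  by (simp add: interval_mass_eq_weight_Icc emeasure_weight_Icc)

lemma interval_mass_eq_weight_Ioo:
  assumes "fst I < snd I"
  shows "interval_mass (\<lambda>x. \<bar>x\<bar>) I = emeasure weight {fst I<..<snd I}"
proof -
  have "{fst I..snd I} = insert (fst I) (insert (snd I) {fst I<..<snd I})"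
    using assms by auto
  thus ?thesis
    using assms by (simp add: interval_mass_eq_weight_Icc emeasure_insert)
qed

lemma open_body: "open (body R)"
  unfolding body_def by auto

lemma body_measurable [measurable]: "body R \<in> sets borel"
  using open_body by auto

lemma region_disjoint:
  assumes "region R"
  shows "disjoint_family_on (\<lambda>I. {fst I<..<snd I}) R"
  unfolding disjoint_family_on_def
proof (intro ballI impI)
  fix I J assume "I \<in> R" "J \<in> R" "I \<noteq> J"
  hence "pts I \<inter> pts J = {}" using assms by (auto simp: region_def)
  moreover have "{fst I<..<snd I} \<subseteq> pts I" "{fst J<..<snd J} \<subseteq> pts J" by (auto simp: pts_def)
  ultimately show "{fst I<..<snd I} \<inter> {fst J<..<snd J} = {}" by blast
qed

lemma infsum_emeasure_disjoint:
  assumes "countable R" "disjoint_family_on A R" "\<And>i. i \<in> R \<Longrightarrow> A i \<in> sets N"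
  shows "(\<Sum>\<^sub>\<infinity>i\<in>R. emeasure N (A i)) = emeasure N (\<Union>i\<in>R. A i)"
proof (cases "finite R")
  case True
  thus ?thesis using assms by (simp add: sum_emeasure image_subset_iff)
next
  case False
  define e where "e = from_nat_into R"
  have bij: "bij_betw e UNIV R"
    unfolding e_def using assms(1) False by (rule bij_betw_from_nat_into)
  have dis: "disjoint_family (\<lambda>k. A (e k))"
    using assms(2) bij unfolding disjoint_family_on_def bij_betw_def inj_on_def by blast
  have "(\<Sum>\<^sub>\<infinity>i\<in>R. emeasure N (A i)) = (\<Sum>\<^sub>\<infinity>k. emeasure N (A (e k)))"
    using infsum_reindex_bij_betw[OF bij, of "\<lambda>i. emeasure N (A i)"] by simp
  also have "\<dots> = (\<Sum>k. emeasure N (A (e k)))"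
    by (intro sums_unique has_sum_imp_sums has_sum_infsum nonneg_summable_on_complete) simp
  also have "\<dots> = emeasure N (\<Union>k. A (e k))"
    using assms(3) bij dis by (intro suminf_emeasure) (auto simp: bij_betw_def)
  also have "(\<Union>k. A (e k)) = (\<Union>i\<in>R. A i)"
    using bij by (auto simp: bij_betw_def)
  finally show ?thesis .
qed

lemma region_mass_eq_weight_body:
  assumes "region R"
  shows "region_mass (\<lambda>x. \<bar>x\<bar>) R = emeasure weight (body R)"
proof -
  have "region_mass (\<lambda>x. \<bar>x\<bar>) R = (\<Sum>\<^sub>\<infinity>I\<in>R. emeasure weight {fst I<..<snd I})"
    unfolding region_mass_def using assms
    by (intro infsum_cong) (auto simp: region_def interval_mass_eq_weight_Ioo)
  also have "\<dots> = emeasure weight (body R)"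
    unfolding body_def using assms region_disjoint
    by (intro infsum_emeasure_disjoint) (auto simp: region_def)
  finally show ?thesis .
qed

lemma interiors_disjoint:
  assumes "configuration n C" "i \<in> {1..n}" "j \<in> {1..n}" "i \<noteq> j" "I \<in> C i" "J \<in> C j"
  shows "{fst I<..<snd I} \<inter> {fst J<..<snd J} = {}"
proof (rule ccontr)
  assume "\<not> ?thesis"
  then obtain z where z: "fst I < z" "z < snd I" "fst J < z" "z < snd J"
    unfolding disjoint_iff by auto
  define w where "w = (z + min (snd I) (snd J)) / 2"
  have w: "z < w" "w < snd I" "w < snd J" using z by (auto simp: w_def min_def)
  have "pts I \<inter> pts J = {} \<or> (\<exists>x\<in>endpoints I \<inter> endpoints J. pts I \<inter> pts J = {x})"
    using assms by (auto simp: configuration_def)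
  moreover have "z \<in> pts I \<inter> pts J" "w \<in> pts I \<inter> pts J" using z w by (auto simp: pts_def)
  ultimately show False using w by (metis empty_iff less_irrefl singletonD)
qed

lemma bodies_disjoint:
  assumes "configuration n C"
  shows "disjoint_family_on (\<lambda>i. body (C i)) {1..n}"
  unfolding disjoint_family_on_def body_def using interiors_disjoint[OF assms] by blast

definition all_endpoints :: "nat \<Rightarrow> (nat \<Rightarrow> intvl set) \<Rightarrow> real set" where
  "all_endpoints n C = (\<Union>I\<in>all_intervals n C. endpoints I)"

section \<open>Lower bound for the perimeter\<close>

text \<open>
  Only finitely many endpoints lie beyond any given \<open>c > 0\<close>, since their contributions to the finite
  perimeter are at least \<open>c\<close>; so every region that reaches the right half-line has a last right
  endpoint there. Two intervals with the same right endpoint overlap, so the last endpoints of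
  different regions are different points and are counted separately in the perimeter. A region that
  misses the half-line gets the value 0.
\<close>

lemma outermost_endpoints:
  assumes conf: "configuration n C"
    and fin: "(\<Sum>\<^sub>\<infinity>x\<in>all_endpoints n C \<inter> {0<..}. ennreal \<bar>x\<bar>) \<noteq> \<infinity>"
  obtains p where "\<And>i. i \<in> {1..n} \<Longrightarrow> 0 \<le> p i"
    and "\<And>i. i \<in> {1..n} \<Longrightarrow> body (C i) \<inter> {0..} \<subseteq> {0..p i}"
    and "ennreal (\<Sum>i=1..n. p i) \<le> (\<Sum>\<^sub>\<infinity>x\<in>all_endpoints n C \<inter> {0<..}. ennreal \<bar>x\<bar>)"
proof -
  define E where "E = all_endpoints n C \<inter> {0<..}"
  define T where "T i = snd ` C i \<inter> {0<..}" for i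
  have TE: "T i \<subseteq> E" if "i \<in> {1..n}" for i
    using that by (auto simp: T_def E_def all_endpoints_def all_intervals_def endpoints_def)
  have finE: "finite (E \<inter> {c..})" if "0 < c" for c :: real
  proof (rule ccontr)
    assume "infinite (E \<inter> {c..})"
    hence "(\<Sum>\<^sub>\<infinity>x\<in>E \<inter> {c..}. ennreal \<bar>x\<bar>) = \<infinity>"
      using that by (intro infsum_superconst_infinite_ennreal[where b = "ennreal c"])
        (auto intro!: ennreal_leI)
    moreover have "(\<Sum>\<^sub>\<infinity>x\<in>E \<inter> {c..}. ennreal \<bar>x\<bar>) \<le> (\<Sum>\<^sub>\<infinity>x\<in>E. ennreal \<bar>x\<bar>)"
      by (intro infsum_mono_neutral nonneg_summable_on_complete) auto
    ultimately show False using fin by (auto simp: E_def top_unique)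
  qed
  have "\<exists>t. (t = 0 \<or> t \<in> T i) \<and> (T i \<noteq> {} \<longrightarrow> t \<in> T i) \<and> (\<forall>s\<in>T i. s \<le> t)"
    if i: "i \<in> {1..n}" for i
  proof (cases "T i = {}")
    case False
    then obtain t0 where t0: "t0 \<in> T i" by auto
    hence pos: "0 < t0" by (simp add: T_def)
    have f: "finite (T i \<inter> {t0..})"
      by (rule finite_subset[OF _ finE[OF pos]]) (use TE[OF i] in auto)
    define t where "t = Max (T i \<inter> {t0..})"
    have "t \<in> T i \<inter> {t0..}" unfolding t_def using f t0 by (intro Max_in) auto
    moreover have "s \<le> t" if "s \<in> T i" for s
    proof (cases "t0 \<le> s")
      case True
      thus ?thesis unfolding t_def using f that by (intro Max_ge) auto
    qed (use calculation in auto)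
    ultimately show ?thesis by blast
  qed auto
  then obtain p where p: "\<And>i. i \<in> {1..n} \<Longrightarrow>
      (p i = 0 \<or> p i \<in> T i) \<and> (T i \<noteq> {} \<longrightarrow> p i \<in> T i) \<and> (\<forall>s\<in>T i. s \<le> p i)"
    by metis
  have nonneg: "0 \<le> p i" if "i \<in> {1..n}" for i
    using p[OF that] by (auto simp: T_def)
  show ?thesis
  proof (rule that[OF nonneg])
    show "body (C i) \<inter> {0..} \<subseteq> {0..p i}" if i: "i \<in> {1..n}" for i
    proof
      fix x assume "x \<in> body (C i) \<inter> {0..}"
      then obtain I where I: "I \<in> C i" "x < snd I" "0 \<le> x" by (auto simp: body_def)
      hence "snd I \<in> T i" by (auto simp: T_def)
      hence "snd I \<le> p i" using p[OF i] by blast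
      thus "x \<in> {0..p i}" using I by auto
    qed
    define J where "J = {i\<in>{1..n}. p i \<noteq> 0}"
    have pT: "p i \<in> T i" if "i \<in> J" for i using p[of i] that by (auto simp: J_def)
    have inj: "inj_on p J"
    proof (rule inj_onI, rule ccontr)
      fix i j assume ij: "i \<in> J" "j \<in> J" "p i = p j" "i \<noteq> j"
      obtain I I' where I: "I \<in> C i" "snd I = p i" "I' \<in> C j" "snd I' = p j"
        using pT[OF ij(1)] pT[OF ij(2)] by (auto simp: T_def)
      have "fst I < snd I" "fst I' < snd I'"
        using conf ij I unfolding configuration_def region_def J_def by blast+
      hence "(max (fst I) (fst I') + p i) / 2 \<in> {fst I<..<snd I} \<inter> {fst I'<..<snd I'}"
        using I ij by (auto simp: max_def)
      moreover have "{fst I<..<snd I} \<inter> {fst I'<..<snd I'} = {}"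
        using ij I by (intro interiors_disjoint[OF conf]) (auto simp: J_def)
      ultimately show False by auto
    qed
    have "(\<Sum>i=1..n. p i) = (\<Sum>i\<in>J. p i)"
      by (rule sum.mono_neutral_right) (auto simp: J_def)
    also have "\<dots> = (\<Sum>x\<in>p ` J. x)" using inj by (simp add: sum.reindex)
    also have "\<dots> = (\<Sum>x\<in>p ` J. \<bar>x\<bar>)" using nonneg by (intro sum.cong) (auto simp: J_def)
    finally have "ennreal (\<Sum>i=1..n. p i) = (\<Sum>x\<in>p ` J. ennreal \<bar>x\<bar>)" by simp
    also have "\<dots> = (\<Sum>\<^sub>\<infinity>x\<in>p ` J. ennreal \<bar>x\<bar>)" by (simp add: J_def)
    also have "\<dots> \<le> (\<Sum>\<^sub>\<infinity>x\<in>E. ennreal \<bar>x\<bar>)"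
      using pT TE by (intro infsum_mono_neutral nonneg_summable_on_complete) (auto simp: J_def)
    finally show "ennreal (\<Sum>i=1..n. p i)
        \<le> (\<Sum>\<^sub>\<infinity>x\<in>all_endpoints n C \<inter> {0<..}. ennreal \<bar>x\<bar>)" by (simp add: E_def)
  qed
qed

text \<open>
  Reflection turns statements about the right half-line into statements about the left one.
\<close>

definition mirror :: "intvl \<Rightarrow> intvl" where
  "mirror I = (- snd I, - fst I)"

lemma pts_mirror: "pts (mirror I) = uminus ` pts I"
  by (simp add: pts_def mirror_def)

lemma endpoints_mirror: "endpoints (mirror I) = uminus ` endpoints I"
  by (auto simp: endpoints_def mirror_def)

lemma mirror_pts_Int: "pts (mirror I) \<inter> pts (mirror J) = uminus ` (pts I \<inter> pts J)"
  by (simp add: pts_mirror image_Int)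

lemma region_mirror: "region R \<Longrightarrow> region (mirror ` R)"
  unfolding region_def
  by (simp add: mirror_pts_Int del: split_paired_All)
    (metis fst_conv mirror_def neg_less_iff_less snd_conv)

lemma configuration_mirror:
  assumes "configuration n C"
  shows "configuration n (\<lambda>i. mirror ` C i)"
  unfolding configuration_def
proof (intro conjI ballI impI)
  fix i assume "i \<in> {1..n}"
  thus "region (mirror ` C i)" using assms region_mirror by (auto simp: configuration_def)
next
  fix i j I' J'
  assume ij: "i \<in> {1..n}" "j \<in> {1..n}" "i \<noteq> j" and "I' \<in> mirror ` C i" "J' \<in> mirror ` C j"
  then obtain I J where I: "I \<in> C i" "I' = mirror I" "J \<in> C j" "J' = mirror J" by auto
  have "pts I \<inter> pts J = {} \<or> (\<exists>x\<in>endpoints I \<inter> endpoints J. pts I \<inter> pts J = {x})"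
    using assms ij I by (auto simp: configuration_def)
  thus "pts I' \<inter> pts J' = {} \<or> (\<exists>x\<in>endpoints I' \<inter> endpoints J'. pts I' \<inter> pts J' = {x})"
    unfolding I mirror_pts_Int endpoints_mirror by auto
qed

lemma body_mirror: "body (mirror ` R) = uminus ` body R"
  unfolding body_def by (auto simp: mirror_def image_iff) (force intro: bexI[of _ "- _"])+

lemma all_endpoints_mirror: "all_endpoints n (\<lambda>i. mirror ` C i) = uminus ` all_endpoints n C"
  by (auto simp: all_endpoints_def all_intervals_def endpoints_mirror)

text \<open>
  The origin has density 0, so an endpoint at the origin can be dropped from the perimeter.
\<close>

lemma perimeter_split:
  "(\<Sum>\<^sub>\<infinity>x\<in>all_endpoints n C \<inter> {0<..}. ennreal \<bar>x\<bar>)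
     + (\<Sum>\<^sub>\<infinity>x\<in>all_endpoints n (\<lambda>i. mirror ` C i) \<inter> {0<..}. ennreal \<bar>x\<bar>)
   = perimeter (\<lambda>x. \<bar>x\<bar>) n C"
proof -
  let ?E = "all_endpoints n C"
  have "bij_betw uminus (?E \<inter> {..<0}) (all_endpoints n (\<lambda>i. mirror ` C i) \<inter> {0<..})"
    unfolding all_endpoints_mirror by (rule bij_betw_imageI) (auto simp: image_iff)
  from infsum_reindex_bij_betw[OF this, of "\<lambda>x. ennreal \<bar>x\<bar>"]
  have "(\<Sum>\<^sub>\<infinity>x\<in>all_endpoints n (\<lambda>i. mirror ` C i) \<inter> {0<..}. ennreal \<bar>x\<bar>)
      = (\<Sum>\<^sub>\<infinity>x\<in>?E \<inter> {..<0}. ennreal \<bar>x\<bar>)" by simp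
  moreover have "(\<Sum>\<^sub>\<infinity>x\<in>?E \<inter> {0<..}. ennreal \<bar>x\<bar>) + (\<Sum>\<^sub>\<infinity>x\<in>?E \<inter> {..<0}. ennreal \<bar>x\<bar>)
      = (\<Sum>\<^sub>\<infinity>x\<in>?E \<inter> {0<..} \<union> ?E \<inter> {..<0}. ennreal \<bar>x\<bar>)"
    by (intro infsum_Un_disjoint[symmetric] nonneg_summable_on_complete) auto
  moreover have "\<dots> = (\<Sum>\<^sub>\<infinity>x\<in>?E. ennreal \<bar>x\<bar>)"
    by (rule infsum_cong_neutral) auto
  ultimately show ?thesis by (simp add: perimeter_def all_endpoints_def)
qed

lemma sum_measure_weight_le:
  assumes "finite A" "disjoint_family_on V A" "\<And>i. i \<in> A \<Longrightarrow> V i \<in> sets borel"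
    and "\<And>i. i \<in> A \<Longrightarrow> V i \<subseteq> S" "S \<in> sets borel" "emeasure weight S = ennreal m" "0 \<le> m"
  shows "(\<Sum>i\<in>A. measure weight (V i)) \<le> m"
proof -
  have "(\<Sum>i\<in>A. emeasure weight (V i)) = emeasure weight (\<Union>i\<in>A. V i)"
    using assms(1-3) by (intro sum_emeasure) auto
  also have "\<dots> \<le> emeasure weight S" using assms by (intro emeasure_mono) auto
  finally have le: "(\<Sum>i\<in>A. emeasure weight (V i)) \<le> ennreal m" using assms(6) by simp
  have "emeasure weight (V i) \<noteq> \<infinity>" if "i \<in> A" for i
    using emeasure_mono[of "V i" S weight] assms that by (auto simp: top_unique)
  hence "(\<Sum>i\<in>A. emeasure weight (V i)) = (\<Sum>i\<in>A. ennreal (measure weight (V i)))"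
    by (intro sum.cong) (auto simp: emeasure_eq_ennreal_measure)
  also have "\<dots> = ennreal (\<Sum>i\<in>A. measure weight (V i))" by simp
  finally show ?thesis using le assms(7) by simp
qed

text \<open>
  The numbers \<open>r i\<close> are the masses of the regions on the right half-line; the remaining masses lie on
  the left. Each side is bounded through its outermost endpoints.
\<close>

lemma perimeter_ge_side_costs:
  assumes conf: "configuration n C" and mass: "has_masses (\<lambda>x. \<bar>x\<bar>) n M C"
    and fin: "perimeter (\<lambda>x. \<bar>x\<bar>) n C \<noteq> \<infinity>" and M: "\<And>i. i \<in> {1..n} \<Longrightarrow> 0 \<le> M i"
  obtains r where "\<And>i. i \<in> {1..n} \<Longrightarrow> 0 \<le> r i \<and> r i \<le> M i"
    and "ennreal (side_cost {1..n} r + side_cost {1..n} (\<lambda>i. M i - r i))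
      \<le> perimeter (\<lambda>x. \<bar>x\<bar>) n C"
proof -
  let ?R = "\<Sum>\<^sub>\<infinity>x\<in>all_endpoints n C \<inter> {0<..}. ennreal \<bar>x\<bar>"
  let ?L = "\<Sum>\<^sub>\<infinity>x\<in>all_endpoints n (\<lambda>i. mirror ` C i) \<inter> {0<..}. ennreal \<bar>x\<bar>"
  have finR: "?R \<noteq> \<infinity>" and finL: "?L \<noteq> \<infinity>"
    using fin unfolding perimeter_split[symmetric] by auto
  obtain p where p: "\<And>i. i \<in> {1..n} \<Longrightarrow> 0 \<le> p i"
      "\<And>i. i \<in> {1..n} \<Longrightarrow> body (C i) \<inter> {0..} \<subseteq> {0..p i}" "ennreal (\<Sum>i=1..n. p i) \<le> ?R"
    using outermost_endpoints[OF conf finR] by metis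
  obtain q where q: "\<And>i. i \<in> {1..n} \<Longrightarrow> 0 \<le> q i"
      "\<And>i. i \<in> {1..n} \<Longrightarrow> body (mirror ` C i) \<inter> {0..} \<subseteq> {0..q i}"
      "ennreal (\<Sum>i=1..n. q i) \<le> ?L"
    using outermost_endpoints[OF configuration_mirror[OF conf] finL] by metis
  have q': "body (C i) \<inter> {..<0} \<subseteq> {- q i..0}" if "i \<in> {1..n}" for i
  proof
    fix x assume "x \<in> body (C i) \<inter> {..<0}"
    hence "- x \<in> body (mirror ` C i) \<inter> {0..}" by (auto simp: body_mirror)
    thus "x \<in> {- q i..0}" using q(2)[OF that] by auto
  qed
  define r where "r i = measure weight (body (C i) \<inter> {0..})" for i
  define l where "l i = measure weight (body (C i) \<inter> {..<0})" for i
  have rl: "r i + l i = M i" if i: "i \<in> {1..n}" for i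
  proof -
    have em: "emeasure weight (body (C i)) = ennreal (M i)"
      using mass conf i by (auto simp: has_masses_def configuration_def region_mass_eq_weight_body)
    have "measure weight (body (C i)) =
        measure weight (body (C i) \<inter> {0..} \<union> body (C i) \<inter> {..<0})"
      by (rule arg_cong[where f = "measure weight"]) auto
    also have "\<dots> = r i + l i"
      unfolding r_def l_def
    proof (rule measure_Union)
      have "emeasure weight (body (C i) \<inter> S) \<noteq> \<infinity>" if "S \<in> sets borel" for S
        using emeasure_mono[of "body (C i) \<inter> S" "body (C i)" weight] em
        by (auto simp: top_unique)
      thus "emeasure weight (body (C i) \<inter> {0..}) \<noteq> \<infinity>"
        "emeasure weight (body (C i) \<inter> {..<0}) \<noteq> \<infinity>" by auto
    qed auto
    finally show ?thesis using em M[OF i] by (simp add: measure_def)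
  qed
  have disj: "disjoint_family_on (\<lambda>i. body (C i) \<inter> S) A" if "A \<subseteq> {1..n}" for A S
    using bodies_disjoint[OF conf] that unfolding disjoint_family_on_def by blast
  have "side_cost {1..n} r \<le> sum p {1..n}"
  proof (rule side_cost_le_sum)
    fix A b assume A: "A \<subseteq> {1..n}" "0 \<le> b" "\<And>i. i \<in> A \<Longrightarrow> p i \<le> b"
    have "sum r A \<le> b\<^sup>2 / 2"
      unfolding r_def
    proof (rule sum_measure_weight_le[where S = "{0..b}"])
      show "body (C i) \<inter> {0..} \<subseteq> {0..b}" if "i \<in> A" for i
        using p(2)[of i] A(1) A(3)[OF that] that by fastforce
    qed (use A disj in \<open>auto simp: emeasure_weight_Icc power2_eq_square intro: finite_subset\<close>)
    thus "2 * sum r A \<le> b\<^sup>2" by simp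
  qed (use p in auto)
  moreover have "side_cost {1..n} l \<le> sum q {1..n}"
  proof (rule side_cost_le_sum)
    fix A b assume A: "A \<subseteq> {1..n}" "0 \<le> b" "\<And>i. i \<in> A \<Longrightarrow> q i \<le> b"
    have "sum l A \<le> b\<^sup>2 / 2"
      unfolding l_def
    proof (rule sum_measure_weight_le[where S = "{-b..0}"])
      show "body (C i) \<inter> {..<0} \<subseteq> {-b..0}" if "i \<in> A" for i
        using q'[of i] A(1) A(3)[OF that] that by fastforce
    qed (use A disj in \<open>auto simp: emeasure_weight_Icc power2_eq_square intro: finite_subset\<close>)
    thus "2 * sum l A \<le> b\<^sup>2" by simp
  qed (use q in auto)
  moreover have "side_cost {1..n} l = side_cost {1..n} (\<lambda>i. M i - r i)"
    by (rule side_cost_cong) (use rl in \<open>auto simp: algebra_simps\<close>)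
  ultimately have "ennreal (side_cost {1..n} r + side_cost {1..n} (\<lambda>i. M i - r i))
      \<le> ennreal (sum p {1..n} + sum q {1..n})"
    by (intro ennreal_leI) linarith
  also have "\<dots> = ennreal (sum p {1..n}) + ennreal (sum q {1..n})"
    using p(1) q(1) by (intro ennreal_plus sum_nonneg) auto
  also have "\<dots> \<le> ?R + ?L" using p(3) q(3) by (intro add_mono)
  also have "\<dots> = perimeter (\<lambda>x. \<bar>x\<bar>) n C" by (rule perimeter_split)
  finally show ?thesis
  proof (rule that[rotated])
    show "0 \<le> r i \<and> r i \<le> M i" if "i \<in> {1..n}" for i
      using rl[OF that] measure_nonneg[of weight "body (C i) \<inter> {0..}"]
        measure_nonneg[of weight "body (C i) \<inter> {..<0}"]
      unfolding r_def l_def by linarith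
  qed
qed

text \<open>
  The lower bound is a concave function of the masses \<open>r i\<close> on the right, which range over a box.
\<close>

lemma perimeter_ge_vertex:
  assumes conf: "configuration n C" and mass: "has_masses (\<lambda>x. \<bar>x\<bar>) n M C"
    and fin: "perimeter (\<lambda>x. \<bar>x\<bar>) n C \<noteq> \<infinity>" and M: "\<And>i. i \<in> {1..n} \<Longrightarrow> 0 \<le> M i"
  obtains v where "\<And>i. i \<in> {1..n} \<Longrightarrow> v i = 0 \<or> v i = M i"
    and "ennreal (side_cost {1..n} v + side_cost {1..n} (\<lambda>i. M i - v i))
      \<le> perimeter (\<lambda>x. \<bar>x\<bar>) n C"
proof -
  let ?\<phi> = "\<lambda>v. side_cost {1..n} v + side_cost {1..n} (\<lambda>i. M i - v i)"
  obtain r where r: "\<And>i. i \<in> {1..n} \<Longrightarrow> 0 \<le> r i \<and> r i \<le> M i"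
      "ennreal (?\<phi> r) \<le> perimeter (\<lambda>x. \<bar>x\<bar>) n C"
    using perimeter_ge_side_costs[OF assms] by metis
  have "\<exists>v. (\<forall>k\<in>{1..n}. 0 \<le> v k \<and> v k \<le> M k) \<and> (\<forall>k\<in>{1..n}. v k = 0 \<or> v k = M k)
      \<and> ?\<phi> v \<le> ?\<phi> r"
  proof (rule concave_box_vertex[where \<phi> = ?\<phi>])
    fix u :: real and x y :: "nat \<Rightarrow> real"
    assume u: "0 \<le> u" "u \<le> 1"
      and x: "\<And>k. k \<in> {1..n} \<Longrightarrow> 0 \<le> x k \<and> x k \<le> M k"
      and y: "\<And>k. k \<in> {1..n} \<Longrightarrow> 0 \<le> y k \<and> y k \<le> M k"
    have "(\<lambda>i. M i - ((1 - u) * x i + u * y i)) = (\<lambda>i. (1 - u) * (M i - x i) + u * (M i - y i))"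
      by (simp add: algebra_simps)
    moreover have "(1 - u) * side_cost {1..n} x + u * side_cost {1..n} y
        \<le> side_cost {1..n} (\<lambda>i. (1 - u) * x i + u * y i)"
      using u x y by (intro side_cost_concave) auto
    moreover have "(1 - u) * side_cost {1..n} (\<lambda>i. M i - x i)
          + u * side_cost {1..n} (\<lambda>i. M i - y i)
        \<le> side_cost {1..n} (\<lambda>i. (1 - u) * (M i - x i) + u * (M i - y i))"
      using u x y by (intro side_cost_concave) auto
    ultimately show "(1 - u) * ?\<phi> x + u * ?\<phi> y \<le> ?\<phi> (\<lambda>k. (1 - u) * x k + u * y k)"
      by (simp add: distrib_left)
  qed (use r in auto)
  then obtain v where "\<forall>k\<in>{1..n}. v k = 0 \<or> v k = M k" "?\<phi> v \<le> ?\<phi> r" by auto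
  thus ?thesis using that[of v] r(2) by (meson ennreal_leI order_trans)
qed

lemma perimeter_ge_four_bubble_cost:
  assumes M: "0 < M 1" "M 1 \<le> M 2" "M 2 \<le> M 3" "M 3 \<le> M 4"
    and conf: "configuration 4 C" and mass: "has_masses (\<lambda>x. \<bar>x\<bar>) 4 M C"
  shows "ennreal (four_bubble_cost M) \<le> perimeter (\<lambda>x. \<bar>x\<bar>) 4 C"
proof (cases "perimeter (\<lambda>x. \<bar>x\<bar>) 4 C = \<infinity>")
  case False
  have "0 \<le> M i" if "i \<in> {1..4}" for i
  proof -
    have "i = 1 \<or> i = 2 \<or> i = 3 \<or> i = 4" using that by auto
    thus ?thesis using M by auto
  qed
  then obtain v where v: "\<And>i. i \<in> {1..4} \<Longrightarrow> v i = 0 \<or> v i = M i"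
    "ennreal (side_cost {1..4} v + side_cost {1..4} (\<lambda>i. M i - v i))
      \<le> perimeter (\<lambda>x. \<bar>x\<bar>) 4 C"
    using perimeter_ge_vertex[OF conf mass False] by blast
  have "four_bubble_cost M \<le> side_cost {1..4} v + side_cost {1..4} (\<lambda>i. M i - v i)"
    using v(1) by (intro four_bubble_cost_le_vertex M) auto
  thus ?thesis using v(2) by (meson ennreal_leI order_trans)
qed auto

section \<open>The claimed minimizer\<close>

lemma region_mass_singleton [simp]: "region_mass f {I} = interval_mass f I"
  by (simp add: region_mass_def)

text \<open>
  The indices are kept arbitrary so that both mirror images of the layout are covered.
\<close>

lemma four_adjacent_intervals:
  assumes ord: "a < b" "b < 0" "0 < c" "c < d" and idx: "{i, j, k, l} = {1..4::nat}"
    and C: "C i = {(a, b)}" "C j = {(b, 0)}" "C k = {(0, c)}" "C l = {(c, d)}"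
  shows "condensed 4 C" and "perimeter (\<lambda>x. \<bar>x\<bar>) 4 C = ennreal (- a - b + c + d)"
proof -
  have all: "all_intervals 4 C = {(a, b), (b, 0), (0, c), (c, d)}"
    unfolding all_intervals_def idx[symmetric] using C by auto
  have conf: "configuration 4 C"
    unfolding configuration_def idx[symmetric] using ord
    by (auto simp: C region_def pts_def endpoints_def)
  show "condensed 4 C"
    unfolding condensed_def
  proof (intro conjI)
    show "\<exists>Is. set Is = all_intervals 4 C \<and> length Is \<le> 2 * 4
        \<and> successively (\<lambda>I J. snd I = fst J) Is"
      by (rule exI[of _ "[(a, b), (b, 0), (0, c), (c, d)]"]) (auto simp: all)
    show "\<forall>i\<in>{1..4}. finite (C i) \<and> card (C i) \<le> 2"
      unfolding idx[symmetric] using C by auto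
    show "\<exists>I\<in>all_intervals 4 C. 0 \<in> interior (pts I) \<or> 0 \<in> endpoints I"
      by (auto simp: all endpoints_def)
  qed (rule conf)
  have "(\<Union>I\<in>all_intervals 4 C. endpoints I) = {a, b, 0, c, d}"
    by (auto simp: all endpoints_def)
  thus "perimeter (\<lambda>x. \<bar>x\<bar>) 4 C = ennreal (- a - b + c + d)"
    using ord by (simp add: perimeter_def flip: ennreal_plus)
qed

text \<open>
  The masses determine the four endpoints: an interval from the origin to \<open>x\<close> has mass \<open>x\<^sup>2 / 2\<close>.
\<close>

lemma four_bubble_perimeter:
  assumes lay: "four_bubble_layout C" and mass: "has_masses (\<lambda>x. \<bar>x\<bar>) 4 M C"
    and M: "0 < M 1" "0 < M 2" "0 < M 3" "0 < M 4"
  shows "condensed 4 C" and "perimeter (\<lambda>x. \<bar>x\<bar>) 4 C = ennreal (four_bubble_cost M)"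
proof -
  have m: "region_mass (\<lambda>x. \<bar>x\<bar>) (C 1) = ennreal (M 1)" "region_mass (\<lambda>x. \<bar>x\<bar>) (C 2) = ennreal (M 2)"
    "region_mass (\<lambda>x. \<bar>x\<bar>) (C 3) = ennreal (M 3)" "region_mass (\<lambda>x. \<bar>x\<bar>) (C 4) = ennreal (M 4)"
    using mass by (auto simp: has_masses_def)
  obtain a b c d where ord: "a < b" "b < 0" "0 < c" "c < d"
    and lay: "C 3 = {(a, b)} \<and> C 1 = {(b, 0)} \<and> C 2 = {(0, c)} \<and> C 4 = {(c, d)} \<or>
         C 4 = {(a, b)} \<and> C 2 = {(b, 0)} \<and> C 1 = {(0, c)} \<and> C 3 = {(c, d)}"
    using lay by (auto simp: four_bubble_layout_def)
  have sq: "b\<^sup>2 < a\<^sup>2" "c\<^sup>2 < d\<^sup>2"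
    using ord by (simp_all flip: abs_le_square_iff add: linorder_not_le[symmetric])
  have "condensed 4 C \<and> perimeter (\<lambda>x. \<bar>x\<bar>) 4 C = ennreal (four_bubble_cost M)"
    using lay
  proof
    assume C: "C 3 = {(a, b)} \<and> C 1 = {(b, 0)} \<and> C 2 = {(0, c)} \<and> C 4 = {(c, d)}"
    have idx: "{3, 1, 2, 4} = {1..4::nat}" by auto
    have "a\<^sup>2 = 2 * (M 1 + M 3)" "b\<^sup>2 = 2 * M 1" "c\<^sup>2 = 2 * M 2" "d\<^sup>2 = 2 * (M 2 + M 4)"
      using m M C ord sq by (auto simp: interval_mass_eq power2_eq_square)
    hence "- a = sqrt (2 * (M 1 + M 3))" "- b = sqrt (2 * M 1)" "c = sqrt (2 * M 2)"
        "d = sqrt (2 * (M 2 + M 4))"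
      using ord by (metis abs_of_neg abs_of_pos less_trans real_sqrt_abs)+
    thus ?thesis
      using four_adjacent_intervals[OF ord idx, of C] C
      by (simp add: four_bubble_cost_def add_ac diff_conv_add_uminus del: add_uminus_conv_diff)
  next
    assume C: "C 4 = {(a, b)} \<and> C 2 = {(b, 0)} \<and> C 1 = {(0, c)} \<and> C 3 = {(c, d)}"
    have idx: "{4, 2, 1, 3} = {1..4::nat}" by auto
    have "a\<^sup>2 = 2 * (M 2 + M 4)" "b\<^sup>2 = 2 * M 2" "c\<^sup>2 = 2 * M 1" "d\<^sup>2 = 2 * (M 1 + M 3)"
      using m M C ord sq by (auto simp: interval_mass_eq power2_eq_square)
    hence "- a = sqrt (2 * (M 2 + M 4))" "- b = sqrt (2 * M 2)" "c = sqrt (2 * M 1)"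
        "d = sqrt (2 * (M 1 + M 3))"
      using ord by (metis abs_of_neg abs_of_pos less_trans real_sqrt_abs)+
    thus ?thesis
      using four_adjacent_intervals[OF ord idx, of C] C
      by (simp add: four_bubble_cost_def add_ac diff_conv_add_uminus del: add_uminus_conv_diff)
  qed
  thus "condensed 4 C" "perimeter (\<lambda>x. \<bar>x\<bar>) 4 C = ennreal (four_bubble_cost M)" by auto
qed

lemma four_bubble_exists:
  fixes M :: "nat \<Rightarrow> real"
  assumes M: "0 < M 1" "0 < M 2" "0 < M 3" "0 < M 4"
  shows "\<exists>C. four_bubble_layout C \<and> has_masses (\<lambda>x. \<bar>x\<bar>) 4 M C"
proof -
  define a b c d where abcd: "a = - sqrt (2 * (M 1 + M 3))" "b = - sqrt (2 * M 1)"
    "c = sqrt (2 * M 2)" "d = sqrt (2 * (M 2 + M 4))"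
  define C :: "nat \<Rightarrow> intvl set" where
    "C i = (if i = 3 then {(a, b)} else if i = 1 then {(b, 0)}
      else if i = 2 then {(0, c)} else {(c, d)})" for i
  have ord: "a < b" "b < 0" "0 < c" "c < d" using M by (auto simp: abcd)
  have layout: "four_bubble_layout C"
    unfolding four_bubble_layout_def
    by (rule exI[of _ a], rule exI[of _ b], rule exI[of _ c], rule exI[of _ d])
       (use ord in \<open>simp add: C_def\<close>)
  have "a * \<bar>a\<bar> = - (2 * (M 1 + M 3))" "b * \<bar>b\<bar> = - (2 * M 1)" "c * \<bar>c\<bar> = 2 * M 2"
    "d * \<bar>d\<bar> = 2 * (M 2 + M 4)"
    using M by (auto simp: abcd)
  hence "has_masses (\<lambda>x. \<bar>x\<bar>) 4 M C"
    unfolding has_masses_def using ord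
    by (auto simp: C_def interval_mass_eq)
      (auto simp: eval_nat_numeral le_Suc_eq diff_divide_distrib add_divide_distrib)
  with layout show ?thesis by blast
qed

theorem theorem5p5:
  fixes M :: "nat \<Rightarrow> real"
  assumes "0 < M 1" and "M 1 \<le> M 2" and "M 2 \<le> M 3" and "M 3 \<le> M 4"
  shows "(\<exists>C. four_bubble_layout C \<and> has_masses (\<lambda>x. \<bar>x\<bar>) 4 M C) \<and>
    (\<forall>C. four_bubble_layout C \<and> has_masses (\<lambda>x. \<bar>x\<bar>) 4 M C \<longrightarrow>
       condensed 4 C \<and> isoperimetric (\<lambda>x. \<bar>x\<bar>) 4 M C)"
proof -
  have pos: "0 < M 1" "0 < M 2" "0 < M 3" "0 < M 4" using assms by auto
  have "condensed 4 C \<and> isoperimetric (\<lambda>x. \<bar>x\<bar>) 4 M C"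
    if C: "four_bubble_layout C" "has_masses (\<lambda>x. \<bar>x\<bar>) 4 M C" for C
    using four_bubble_perimeter[OF C pos] perimeter_ge_four_bubble_cost[OF assms] C(2)
    by (auto simp: isoperimetric_def condensed_def)
  thus ?thesis using four_bubble_exists[OF pos] by blast
qed

end
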